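(* Let $\theta\in\mathbb R\setminus\mathbb Q$ and let $\{\cdot\}$ denote the fractional part function. Let $g_{\mathrm H}(z)=\sum_{k=1}^\infty\{k\theta\}z^k$ for $z\in\mathbb D$. Then: 1. $g_{\mathrm H}$ has a unique rrl-continuation, which is $$g_{\mathrm H}^-(z)=-\sum_{n<0}\{n\theta\}z^n=g_{\mathrm H}(z^{-1})+(1-z)^{-1},\qquad z\in\mathbb E.$$ 2. The function $z^{-1}g_{\mathrm H}(z)=\sum_{k=0}^\infty\{(k+1)\theta\}z^k$ has exactly two rrl-continuations, namely $$-\sum_{n<0}\{(n+1)\theta\}z^n=z^{-1}g_{\mathrm H}^-(z)\qquad\text{and}\qquad -z^{-1}+z^{-1}g_{\mathrm H}^-(z).$$ 3. The unit circle is a strong natural boundary both for $g_{\mathrm H}(z)$ and for $z^{-1}g_{\mathrm H}(z)$.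
   Context: Notation: $\mathbb D=\{z\in\mathbb C: |z|<1\}$, $\mathbb E=\{z\in\mathbb C:|z|>1\}\cup\{\infty\}\subset\widehat{\mathbb C}$; $\{x\}=x-\lfloor x\rfloor$. Right limits: a right limit of a bounded sequence $(a_k)_{k\ge0}$ of complex numbers is a two-sided sequence $(b_n)_{n\in\mathbb Z}$ for which there is a strictly increasing sequence of positive integers $(k_j)_{j\ge1}$ with $\lim_{j\to\infty}a_{n+k_j}=b_n$ for every $n\in\mathbb Z$. It is renascent if $b_n=a_n$ for all $n\ge0$. rrl-continuation: if $g(z)=\sum_{k\ge0}a_kz^k$ is holomorphic on $\mathbb D$ with bounded $(a_k)$ and $(b_n)_{n\in\mathbb Z}$ is a renascent right limit of $(a_k)$, then the function $z\mapsto-\sum_{n<0}b_nz^n$ on $\mathbb E$ is called an rrl-continuation of $g$. Strong natural boundary: the unit circle is a strong natural boundary for a holomorphic function $g$ on $\mathbb D$ if, for every nonempty open interval $(\omega_1,\omega_2)$, $\sup_{0<r<1}\int_{\omega_1}^{\omega_2}|g(re^{i\omega})|\,d\omega=\infty$. *)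

theory Defs
  imports "HOL-Analysis.Analysis"
begin

text \<open>
  The Riemann sphere is represented by \<^typ>\<open>complex option\<close>, with \<open>None\<close> as the point at infinity.
  Maps on the sphere fixing infinity, such as \<open>z \<mapsto> 1 - z\<close>, are written with \<^const>\<open>map_option\<close>.
\<close>

type_synonym riemann_sphere = "complex option"

abbreviation unit_disc :: "complex set" where
  "unit_disc \<equiv> ball 0 1"

definition outer_disc :: "riemann_sphere set" where
  "outer_disc = insert None (Some ` {z. 1 < norm z})"

text \<open>
  \<open>z\<inverse>\<close> as a complex number, with value 0 at infinity. It is meaningful except at \<open>Some 0\<close>, where
  the true value is infinity; it is used only away from that point.
\<close>

definition sphere_inverse :: "riemann_sphere \<Rightarrow> complex" where
  "sphere_inverse z = (case z of None \<Rightarrow> 0 | Some w \<Rightarrow> inverse w)"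

text \<open>\<open>- (\<Sum>n<0. b n * z powi n)\<close>, where \<open>z powi n\<close> is written as a natural power of \<open>z\<inverse>\<close>.\<close>

definition outer_series :: "(int \<Rightarrow> complex) \<Rightarrow> riemann_sphere \<Rightarrow> complex" where
  "outer_series b z = - (\<Sum>\<^sub>\<infinity>n\<in>{..<0}. b n * sphere_inverse z ^ nat (- n))"

text \<open>
  For fixed \<open>n\<close> the index \<open>n + k j\<close> is negative for only finitely many \<open>j\<close>, so the truncation
  by \<^const>\<open>nat\<close> does not affect the limit.
\<close>

definition right_limit :: "(nat \<Rightarrow> complex) \<Rightarrow> (int \<Rightarrow> complex) \<Rightarrow> bool" where
  "right_limit a b \<longleftrightarrow> bounded (range a) \<and>
     (\<exists>k :: nat \<Rightarrow> nat. strict_mono k \<and> (\<forall>j. 0 < k j) \<and>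
        (\<forall>n :: int. (\<lambda>j. a (nat (n + int (k j)))) \<longlonglongrightarrow> b n))"

definition renascent_right_limit :: "(nat \<Rightarrow> complex) \<Rightarrow> (int \<Rightarrow> complex) \<Rightarrow> bool" where
  "renascent_right_limit a b \<longleftrightarrow> right_limit a b \<and> (\<forall>n. b (int n) = a n)"

text \<open>
  A function on the outer disc is represented by its extension with value \<^const>\<open>undefined\<close> outside
  that set, so that equality of such functions is equality on the outer disc.
\<close>

definition rrl_continuation :: "(complex \<Rightarrow> complex) \<Rightarrow> (riemann_sphere \<Rightarrow> complex) \<Rightarrow> bool" where
  "rrl_continuation g h \<longleftrightarrow> g holomorphic_on unit_disc \<and>
     (\<exists>a b. bounded (range a) \<and> (\<forall>z\<in>unit_disc. (\<lambda>k. a k * z ^ k) sums g z) \<and>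
        renascent_right_limit a b \<and> h = restrict (outer_series b) outer_disc)"

definition strong_natural_boundary :: "(complex \<Rightarrow> complex) \<Rightarrow> bool" where
  "strong_natural_boundary g \<longleftrightarrow> g holomorphic_on unit_disc \<and>
     (\<forall>\<omega>\<^sub>1 \<omega>\<^sub>2 :: real. \<omega>\<^sub>1 < \<omega>\<^sub>2 \<longrightarrow>
        (SUP r\<in>{0<..<1}. \<integral>\<^sup>+\<omega>\<in>{\<omega>\<^sub>1<..<\<omega>\<^sub>2}. ennreal (norm (g (complex_of_real r * cis \<omega>))) \<partial>lborel) = \<infinity>)"

definition g_H :: "real \<Rightarrow> complex \<Rightarrow> complex" where
  "g_H \<theta> z = (\<Sum>k. complex_of_real (frac (real (Suc k) * \<theta>)) * z ^ Suc k)"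

text \<open>
  The holomorphic function on the disc given by \<open>z\<inverse> * g_H \<theta> z\<close>, with the removable singularity at 0
  filled in (whereas \<open>inverse 0 = 0\<close> in HOL).
\<close>

definition g_H_shift :: "real \<Rightarrow> complex \<Rightarrow> complex" where
  "g_H_shift \<theta> z = (\<Sum>k. complex_of_real (frac (real (k + 1) * \<theta>)) * z ^ k)"

definition g_H_minus :: "real \<Rightarrow> riemann_sphere \<Rightarrow> complex" where
  "g_H_minus \<theta> = outer_series (\<lambda>n. complex_of_real (frac (real_of_int n * \<theta>)))"

end

theory Submission
  imports Defs "HOL-Complex_Analysis.Cauchy_Integral_Formula"
begin

text \<open>
  Along a sequence defining a renascent right limit, the coefficient at index 1 forces
  \<open>k\<^sub>j \<theta> \<rightarrow> 0\<close> modulo 1. This determines every entry of the limit except the one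
  corresponding to \<open>{0 \<cdot> \<theta>}\<close>, which is 0 or 1 according to the side from which 0 is approached.

  For the boundary behaviour, fix \<open>p\<close> with \<open>\<delta> = {p \<theta>}\<close> small. Comparing \<open>{(k + p) \<theta>}\<close> with
  \<open>{k \<theta>} + \<delta>\<close> gives a functional equation for \<open>g\<^sub>H\<close> whose error term is the power series with 0/1
  coefficients marking the carries. At the point 1 the equation says that the carries have density
  \<open>\<delta>\<close>; at the point \<open>e\<^bsup>-2\<pi>im\<theta>\<^esup>\<close> with \<open>m \<noteq> 0\<close> it then yields, for \<open>\<delta>\<close> small, that
  \<open>g\<^sub>H\<close> grows nontangentially at least like a simple pole there, with a constant independent of the aperture
  of the Stolz angle. Over the part of an arc within distance \<open>K (1 - r)\<close> of such a point the
  integral of \<open>|g\<^sub>H|\<close> is therefore at least a constant times \<open>ln (1 + K)\<close> for \<open>r\<close> close to 1, and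
  these points are dense in the circle.
\<close>

section \<open>Power series with bounded coefficients\<close>

lemma bounded_powser_summable:
  fixes a :: "nat \<Rightarrow> complex"
  assumes "bounded (range a)" "norm z < 1"
  shows "summable (\<lambda>k. norm (a k * z ^ k))"
proof -
  obtain B where B: "\<And>k. norm (a k) \<le> B"
    using assms(1) by (auto simp: bounded_iff)
  have "summable (\<lambda>k. B * norm z ^ k)"
    using assms(2) by (intro summable_mult summable_geometric) auto
  then show ?thesis
    by (rule summable_comparison_test')
      (auto simp: norm_mult norm_power intro!: mult_right_mono B)
qed

text \<open>Zeros of a nonzero power series are isolated, so the difference of the two series, which
  vanishes on the disc, has no nonzero coefficient. Index 0 is read off at the point 0.\<close>

lemma powser_coeffs_unique:
  fixes a b :: "nat \<Rightarrow> complex"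
  assumes "\<forall>z\<in>unit_disc. (\<lambda>k. a k * z ^ k) sums g z"
    and "\<forall>z\<in>unit_disc. (\<lambda>k. b k * z ^ k) sums g z"
  shows "a = b"
proof
  fix m
  have sums: "(\<lambda>k. (a k - b k) * (z - 0) ^ k) sums 0" if "norm (z - 0) < 1" for z
    using sums_diff[OF assms(1)[rule_format, of z] assms(2)[rule_format, of z]] that
    by (simp add: algebra_simps)
  show "a m = b m"
  proof (cases "m = 0")
    case True
    have "(\<lambda>k. (a k - b k) * 0 ^ k) sums 0"
      using sums[of 0] by simp
    then have "a 0 - b 0 = 0"
      by (simp add: powser_sums_zero_iff)
    with True show ?thesis by simp
  next
    case False
    show ?thesis
    proof (rule ccontr)
      assume "a m \<noteq> b m"
      then obtain s :: real where s: "0 < s" "\<And>z::complex. z \<in> cball 0 s - {0} \<Longrightarrow> (0::complex) \<noteq> 0"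
        using powser_0_nonzero[of 1 0 "\<lambda>k. a k - b k" "\<lambda>_. 0" m] sums False by auto
      from s(2)[of "of_real s"] s(1) show False by auto
    qed
  qed
qed

text \<open>The quantifier over coefficient sequences collapses because the values of
  \<open>g\<close> on the disc determine them; only the choice of right limit remains.\<close>

lemma rrl_continuation_iff:
  assumes a: "bounded (range a)" and sums: "\<forall>z\<in>unit_disc. (\<lambda>k. a k * z ^ k) sums g z"
  shows "rrl_continuation g h \<longleftrightarrow>
    (\<exists>b. renascent_right_limit a b \<and> h = restrict (outer_series b) outer_disc)"
proof -
  have "g holomorphic_on unit_disc"
    using sums by (intro power_series_holomorphic[where a = a]) auto
  moreover have "a' = a" if "\<forall>z\<in>unit_disc. (\<lambda>k. a' k * z ^ k) sums g z" for a'
    using powser_coeffs_unique[OF that sums] .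
  ultimately show ?thesis
    unfolding rrl_continuation_def using a sums by metis
qed

lemma bounded_frac: "bounded (range (\<lambda>k. complex_of_real (frac (x k))))"
  unfolding bounded_iff by (intro exI[of _ 1]) (auto simp: frac_lt_1 less_imp_le)

lemma g_H_shift_sums:
  assumes "norm z < 1"
  shows "(\<lambda>k. of_real (frac (real (k + 1) * \<theta>)) * z ^ k) sums g_H_shift \<theta> z"
  unfolding g_H_shift_def
  by (intro summable_sums summable_norm_cancel[OF bounded_powser_summable] bounded_frac assms)

lemma g_H_eq_shift:
  assumes "norm z < 1"
  shows "g_H \<theta> z = z * g_H_shift \<theta> z"
  using sums_mult[OF g_H_shift_sums[OF assms, of \<theta>], of z]
  unfolding g_H_def by (intro sums_unique[symmetric]) (simp add: mult_ac)

lemma g_H_sums: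
  assumes "norm z < 1"
  shows "(\<lambda>k. of_real (frac (real k * \<theta>)) * z ^ k) sums g_H \<theta> z"
proof (rule sums_Suc_imp)
  show "(\<lambda>k. of_real (frac (real (Suc k) * \<theta>)) * z ^ Suc k) sums g_H \<theta> z"
    using sums_mult[OF g_H_shift_sums[OF assms, of \<theta>], of z]
    by (simp add: g_H_eq_shift[OF assms] mult.left_commute)
qed simp

section \<open>Renascent right limits of fractional parts\<close>

text \<open>Off the integers, \<open>frac x + y j\<close> eventually lies strictly between 0 and 1
  and is then itself the fractional part.\<close>

lemma tendsto_frac_perturbed:
  fixes x :: real
  assumes "x \<notin> \<int>" and "y \<longlonglongrightarrow> 0"
  shows "(\<lambda>j. frac (x + y j)) \<longlonglongrightarrow> frac x"
proof -
  have "(\<lambda>j. frac x + y j) \<longlonglongrightarrow> frac x + 0"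
    using assms(2) by (intro tendsto_intros)
  then have lim: "(\<lambda>j. frac x + y j) \<longlonglongrightarrow> frac x" by simp
  have "0 < frac x" "frac x < 1" using assms(1) frac_lt_1 by auto
  then have "\<forall>\<^sub>F j in sequentially. 0 < frac x + y j \<and> frac x + y j < 1"
    using lim by (simp add: eventually_conj order_tendstoD)
  then have "\<forall>\<^sub>F j in sequentially. frac x + y j = frac (x + y j)"
  proof eventually_elim
    case (elim j)
    then have "frac (frac x + y j) = frac x + y j" by (intro frac_eq[THEN iffD2]) auto
    moreover have "x + y j = frac x + y j + of_int \<lfloor>x\<rfloor>" by (simp add: frac_def)
    ultimately show ?case by (metis frac_add_of_int_right)
  qed
  with lim show ?thesis by (rule Lim_transform_eventually)
qed

section \<open>Multiples of an irrational number modulo 1\<close>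

lemma irrational_int_mult:
  fixes \<theta> :: real
  assumes "\<theta> \<notin> \<rat>" "n \<noteq> 0"
  shows "of_int n * \<theta> \<notin> \<int>"
proof
  assume "of_int n * \<theta> \<in> \<int>"
  then have "of_int n * \<theta> / of_int n \<in> \<rat>"
    using Ints_subset_Rats by (intro Rats_divide) auto
  with assms show False by simp
qed

lemma frac_mult_near_endpoint:
  fixes \<theta> :: real
  assumes \<theta>: "\<theta> \<notin> \<rat>" and t: "t \<in> {0, 1}" and \<epsilon>: "0 < \<epsilon>"
  shows "\<exists>k>N. \<bar>frac (real k * \<theta>) - t\<bar> < \<epsilon>"
proof -
  \<comment> \<open>The first \<open>N\<close> multiples miss \<open>t\<close>; a tolerance no
    larger than their distances from \<open>t\<close> forces the Kronecker index beyond
    \<open>N\<close>.\<close>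
  define \<delta> where "\<delta> = Min (insert \<epsilon> ((\<lambda>k. \<bar>frac (real k * \<theta>) - t\<bar>) ` {1..N}))"
  have "frac (real k * \<theta>) \<noteq> t" if "k \<in> {1..N}" for k
    using irrational_int_mult[OF \<theta>, of "int k"] that t frac_lt_1[of "real k * \<theta>"] by auto
  then have "\<delta> > 0"
    unfolding \<delta>_def using \<epsilon> by (subst Min_gr_iff) auto
  moreover have "0 \<le> t" "t \<le> 1" using t by auto
  ultimately obtain k where k: "k > 0" "\<bar>frac (real k * \<theta>) - t\<bar> < \<delta>"
    using Kronecker_approx_1_explicit[OF \<theta>, of t \<delta>] by metis
  have "\<delta> \<le> \<epsilon>" unfolding \<delta>_def by simp
  moreover have "k > N"
  proof (rule ccontr)
    assume "\<not> k > N"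
    then have "\<delta> \<le> \<bar>frac (real k * \<theta>) - t\<bar>"
      unfolding \<delta>_def using k(1) by (intro Min_le) auto
    with k(2) show False by simp
  qed
  ultimately show ?thesis using k(2) by force
qed

text \<open>The value \<open>t = 0\<close> means approaching the integers from above,
  \<open>t = 1\<close> from below; these sequences realise the two right limits of the shifted
  coefficients.\<close>

lemma frac_mult_endpoint_sequence:
  fixes \<theta> :: real
  assumes \<theta>: "\<theta> \<notin> \<rat>" and t: "t \<in> {0, 1}"
  obtains k :: "nat \<Rightarrow> nat" where "strict_mono k" "\<And>j. 0 < k j"
    "(\<lambda>j. frac (real (k j) * \<theta>)) \<longlonglongrightarrow> t"
proof -
  have "\<exists>k. \<forall>n. (0 < k n \<and> \<bar>frac (real (k n) * \<theta>) - t\<bar> < inverse (real (Suc n))) \<and> k n < k (Suc n)"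
  proof (rule dependent_nat_choice)
    show "\<exists>y. (0 < y \<and> \<bar>frac (real y * \<theta>) - t\<bar> < inverse (real (Suc (Suc n)))) \<and> x < y" for x n
    proof -
      obtain k where "k > x" "\<bar>frac (real k * \<theta>) - t\<bar> < inverse (real (Suc (Suc n)))"
        using frac_mult_near_endpoint[OF \<theta> t, of "inverse (real (Suc (Suc n)))" x] by auto
      then show ?thesis by (intro exI[of _ k]) simp
    qed
    show "\<exists>x. 0 < x \<and> \<bar>frac (real x * \<theta>) - t\<bar> < inverse (real (Suc 0))"
      using frac_mult_near_endpoint[OF \<theta> t, of 1 0] by auto
  qed
  then obtain k where k: "\<And>n. 0 < k n" "\<And>n. k n < k (Suc n)"
    "\<And>n. \<bar>frac (real (k n) * \<theta>) - t\<bar> < inverse (real (Suc n))" by auto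
  have "(\<lambda>n. frac (real (k n) * \<theta>) - t) \<longlonglongrightarrow> 0"
    using k(3) by (intro Lim_null_comparison[OF always_eventually LIMSEQ_inverse_real_of_nat])
      (auto intro: less_imp_le)
  then show thesis
    using that[of k] k by (auto simp: strict_mono_Suc_iff LIM_zero_iff)
qed

text \<open>Once \<open>k j * \<theta>\<close> tends to 0 modulo 1, continuity of
  \<open>frac\<close> fixes every entry except the one at \<open>- s\<close>, where the argument is
  0. For \<open>s = 0\<close> renascence fixes that entry too; for \<open>s > 0\<close> its index is
  negative and both one-sided values occur.\<close>

lemma renascent_right_limit_frac_iff:
  fixes \<theta> :: real and s :: nat
  assumes \<theta>: "\<theta> \<notin> \<rat>"
  defines "a \<equiv> \<lambda>k. complex_of_real (frac (real (k + s) * \<theta>))"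
  shows "renascent_right_limit a b \<longleftrightarrow>
    (\<forall>n. n \<noteq> - int s \<longrightarrow> b n = of_real (frac (of_int (n + int s) * \<theta>))) \<and>
    (b (- int s) = 0 \<or> (0 < s \<and> b (- int s) = 1))"
proof -
  \<comment> \<open>Any representative \<open>y j\<close> of \<open>k j * \<theta>\<close> modulo 1
    is allowed; the two directions use different ones. Truncation by \<open>nat\<close> is harmless
    once \<open>j \<ge> - n\<close>, since \<open>k j \<ge> j\<close>.\<close>
  have a_shift: "\<forall>\<^sub>F j in sequentially. a (nat (n + int (k j)))
      = of_real (frac (of_int (n + int s) * \<theta> + y j))"
    if k: "strict_mono k" and y: "\<And>j. real (k j) * \<theta> - y j \<in> \<int>" for k :: "nat \<Rightarrow> nat" and y n
  proof -
    have "\<forall>\<^sub>F j in sequentially. nat (- n) \<le> j" by (rule eventually_ge_at_top)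
    then show ?thesis
    proof eventually_elim
      case (elim j)
      then have "nat (- n) \<le> k j" using strict_mono_imp_increasing[OF k, of j] by linarith
      then have n: "real (nat (n + int (k j))) = of_int n + real (k j)" by linarith
      have "real (nat (n + int (k j)) + s) * \<theta>
        = (of_int (n + int s) * \<theta> + y j) + (real (k j) * \<theta> - y j)"
        by (simp add: n algebra_simps)
      then show ?case unfolding a_def by (simp only: frac_add_int_right[OF y])
    qed
  qed
  have lim: "(\<lambda>j. a (nat (n + int (k j)))) \<longlonglongrightarrow> of_real (frac (of_int (n + int s) * \<theta>))"
    if k: "strict_mono k" and y: "y \<longlonglongrightarrow> 0" and n: "n \<noteq> - int s"
      and eq: "\<forall>\<^sub>F j in sequentially. a (nat (n + int (k j))) = of_real (frac (of_int (n + int s) * \<theta> + y j))"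
    for k :: "nat \<Rightarrow> nat" and y n
  proof -
    have "(\<lambda>j. complex_of_real (frac (of_int (n + int s) * \<theta> + y j))) \<longlonglongrightarrow> of_real (frac (of_int (n + int s) * \<theta>))"
      using n y by (intro tendsto_of_real tendsto_frac_perturbed irrational_int_mult[OF \<theta>]) auto
    then show ?thesis by (rule Lim_transform_eventually) (use eq in eventually_elim, simp)
  qed
  have bdd: "bounded (range a)"
    unfolding a_def by (rule bounded_frac)
  show ?thesis
  proof
    assume "renascent_right_limit a b"
    then obtain k where k: "strict_mono k" and ab: "\<And>n. (\<lambda>j. a (nat (n + int (k j)))) \<longlonglongrightarrow> b n"
      and ren: "\<And>n. b (int n) = a n"
      unfolding renascent_right_limit_def right_limit_def by blast
    \<comment> \<open>Comparing index 1 before and after the shift by \<open>k j\<close> gives a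
      representative that tends to 0, because the limit entry at 1 is \<open>a 1\<close>.\<close>
    define y where "y j = frac (real (nat (1 + int (k j)) + s) * \<theta>) - frac (real (1 + s) * \<theta>)" for j
    have "(\<lambda>j. complex_of_real (y j)) \<longlonglongrightarrow> a 1 - a 1"
      using tendsto_diff[OF ab[of 1] tendsto_const[of "a 1"]] ren[of 1] by (simp add: y_def a_def)
    then have y: "y \<longlonglongrightarrow> 0"
      using tendsto_of_real_iff[where 'a = complex, of y 0] by simp
    have "real (k j) * \<theta> - y j = of_int (\<lfloor>real (nat (1 + int (k j)) + s) * \<theta>\<rfloor> - \<lfloor>real (1 + s) * \<theta>\<rfloor>)" for j
      by (simp add: y_def frac_def nat_add_distrib algebra_simps)
    then have "real (k j) * \<theta> - y j \<in> \<int>" for j by simp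
    note eq = a_shift[OF k this]
    have "b n = of_real (frac (of_int (n + int s) * \<theta>))" if "n \<noteq> - int s" for n
      using LIMSEQ_unique[OF ab lim[OF k y that eq]] .
    moreover have "b (- int s) = 0 \<or> b (- int s) = 1"
    proof -
      define c where "c j = a (nat (- int s + int (k j)))" for j
      have c: "c \<longlonglongrightarrow> b (- int s)" unfolding c_def by (rule ab)
      \<comment> \<open>\<open>frac (y j)\<close> is \<open>y j\<close> or \<open>1 + y j\<close>, so any limit is a root of \<open>c * (1 - c)\<close>.\<close>
      have "\<forall>\<^sub>F j in sequentially. \<bar>y j\<bar> < 1"
        using order_tendstoD(2)[OF tendsto_rabs_zero[OF y], of 1] by simp
      then have "\<forall>\<^sub>F j in sequentially. norm (c j * (1 - c j)) \<le> \<bar>y j\<bar>"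
        using eq[of "- int s"]
      proof eventually_elim
        case (elim j)
        have c: "c j = of_real (frac (y j))" using elim by (simp add: c_def)
        have "frac (y j) = y j \<or> frac (y j) = 1 + y j"
          using elim(1) frac_eq[of "y j"] frac_unique_iff[of "y j" "1 + y j"] by force
        then have "frac (y j) * (1 - frac (y j)) \<le> \<bar>y j\<bar>"
        proof
          assume h: "frac (y j) = y j"
          show ?thesis
            using mult_left_mono[of "1 - frac (y j)" 1 "frac (y j)"] frac_ge_0[of "y j"] h by auto
        next
          assume h: "frac (y j) = 1 + y j"
          show ?thesis
            using mult_right_mono[of "frac (y j)" 1 "1 - frac (y j)"] h frac_lt_1[of "y j"] by auto
        qed
        moreover have "c j * (1 - c j) = of_real (frac (y j) * (1 - frac (y j)))"
          by (simp add: c)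
        then have "norm (c j * (1 - c j)) = frac (y j) * (1 - frac (y j))"
          using frac_lt_1[of "y j"] by (simp only: norm_of_real) simp
        ultimately show ?case by simp
      qed
      then have "(\<lambda>j. c j * (1 - c j)) \<longlonglongrightarrow> 0"
        by (rule Lim_null_comparison) (use tendsto_rabs_zero[OF y] in simp)
      moreover have "(\<lambda>j. c j * (1 - c j)) \<longlonglongrightarrow> b (- int s) * (1 - b (- int s))"
        by (intro tendsto_intros c)
      ultimately show ?thesis using LIMSEQ_unique by fastforce
    qed
    moreover have "b (- int s) = 0" if "s = 0"
      using ren[of 0] that by (simp add: a_def)
    ultimately show "(\<forall>n. n \<noteq> - int s \<longrightarrow> b n = of_real (frac (of_int (n + int s) * \<theta>))) \<and>
      (b (- int s) = 0 \<or> (0 < s \<and> b (- int s) = 1))" by blast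
  next
    assume b: "(\<forall>n. n \<noteq> - int s \<longrightarrow> b n = of_real (frac (of_int (n + int s) * \<theta>))) \<and>
      (b (- int s) = 0 \<or> (0 < s \<and> b (- int s) = 1))"
    then obtain t :: real where t: "t \<in> {0,1}" "b (- int s) = of_real t" by auto
    obtain k where k: "strict_mono k" "\<And>j. 0 < k j" "(\<lambda>j. frac (real (k j) * \<theta>)) \<longlonglongrightarrow> t"
      using frac_mult_endpoint_sequence[OF \<theta> t(1)] by blast
    have "(\<lambda>j. a (nat (n + int (k j)))) \<longlonglongrightarrow> b n" for n
    proof (cases "n = - int s")
      case True
      have "(\<lambda>j. complex_of_real (frac (real (k j) * \<theta>))) \<longlonglongrightarrow> b n"
        unfolding True t(2) by (intro tendsto_of_real k)
      moreover have "\<forall>\<^sub>F j in sequentially. of_real (frac (real (k j) * \<theta>)) = a (nat (n + int (k j)))"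
        using a_shift[OF k(1), of "\<lambda>j. frac (real (k j) * \<theta>)" n] True by (simp add: frac_def eq_commute)
      ultimately show ?thesis by (rule Lim_transform_eventually)
    next
      case False
      \<comment> \<open>As \<open>t\<close> is an integer, subtracting it keeps the class modulo 1
        and makes the perturbation tend to 0.\<close>
      have "(\<lambda>j. frac (real (k j) * \<theta>) - t) \<longlonglongrightarrow> 0" using k(3) by (simp add: LIM_zero_iff)
      moreover have "real (k j) * \<theta> - (frac (real (k j) * \<theta>) - t) \<in> \<int>" for j
        using t(1) by (auto simp: frac_def)
      ultimately show ?thesis using lim[OF k(1) _ False a_shift[OF k(1)]] b False by simp
    qed
    moreover have "b (int n) = a n" for n
      using b by (cases "n = 0 \<and> s = 0") (auto simp: a_def)
    ultimately show "renascent_right_limit a b"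
      unfolding renascent_right_limit_def right_limit_def using bdd k by blast
  qed
qed

section \<open>Growth of the Hecke series near the circle\<close>

definition carry :: "real \<Rightarrow> nat \<Rightarrow> nat \<Rightarrow> complex" where
  "carry \<theta> p k = (if 1 \<le> frac (real k * \<theta>) + frac (real p * \<theta>) then 1 else 0)"

lemma bounded_carry: "bounded (range (carry \<theta> p))"
  unfolding bounded_iff carry_def by (intro exI[of _ 1]) auto

definition carry_series :: "real \<Rightarrow> nat \<Rightarrow> complex \<Rightarrow> complex" where
  "carry_series \<theta> p z = (\<Sum>k. carry \<theta> p k * z ^ k)"

lemma carry_series_sums:
  assumes "norm z < 1"
  shows "(\<lambda>k. carry \<theta> p k * z ^ k) sums carry_series \<theta> p z"
  unfolding carry_series_def
  by (intro summable_sums summable_norm_cancel[OF bounded_powser_summable] bounded_carry assms)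

text \<open>Raising the index by \<open>p\<close> adds \<open>{p \<theta>}\<close> and subtracts the
  carry. Multiplying by \<open>z ^ (k + p)\<close> and summing recovers \<open>g_H\<close> without
  its first \<open>p\<close> terms, hence the polynomial.\<close>

lemma g_H_functional_equation:
  assumes z: "norm z < 1"
  shows "g_H \<theta> z * (1 - z ^ p) = (\<Sum>k<p. of_real (frac (real k * \<theta>)) * z ^ k)
    + z ^ p * (of_real (frac (real p * \<theta>)) / (1 - z) - carry_series \<theta> p z)"
proof -
  let ?h = "\<lambda>k. complex_of_real (frac (real k * \<theta>))"
  have h: "?h (k + p) = ?h k + ?h p - carry \<theta> p k" for k
    using frac_add[of "real k * \<theta>" "real p * \<theta>"] by (simp add: carry_def algebra_simps flip: of_real_add)
  have "(\<lambda>k. ?h k * z ^ k + ?h p * z ^ k - carry \<theta> p k * z ^ k) sums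
      (g_H \<theta> z + ?h p * (1 / (1 - z)) - carry_series \<theta> p z)"
    by (intro sums_add sums_diff sums_mult g_H_sums carry_series_sums geometric_sums z)
  then have "(\<lambda>k. ?h (k + p) * z ^ k) sums (g_H \<theta> z + ?h p / (1 - z) - carry_series \<theta> p z)"
    by (simp only: h left_diff_distrib distrib_right times_divide_eq_right mult_1_right)
  from sums_mult[OF this, of "z ^ p"]
  have "(\<lambda>k. ?h (k + p) * z ^ (k + p)) sums (z ^ p * (g_H \<theta> z + ?h p / (1 - z) - carry_series \<theta> p z))"
    by (simp add: power_add mult_ac)
  then have "z ^ p * (g_H \<theta> z + ?h p / (1 - z) - carry_series \<theta> p z) = g_H \<theta> z - (\<Sum>k<p. ?h k * z ^ k)"
    using sums_split_initial_segment[OF g_H_sums[OF z, of \<theta>], of p] sums_unique2 by blast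
  then show ?thesis by (simp add: algebra_simps)
qed

text \<open>The nontangential approach region at the point 1; other boundary points are reached
  through a rotation \<open>q * z\<close>.\<close>

definition stolz :: "real \<Rightarrow> complex set" where
  "stolz K = {z. norm z < 1 \<and> norm (1 - z) \<le> K * (1 - norm z)}"

lemma norm_one_minus_of_real: "norm (1 - complex_of_real x) = \<bar>1 - x\<bar>"
  by (metis norm_of_real of_real_1 of_real_diff)

lemma norm_g_H_le:
  assumes "norm z < 1"
  shows "norm (g_H \<theta> z) \<le> 1 / (1 - norm z)"
proof -
  have "norm (\<Sum>k. complex_of_real (frac (real k * \<theta>)) * z ^ k) \<le> (\<Sum>k. norm z ^ k)"
    using assms
    by (intro norm_suminf_le)
      (auto simp: norm_mult norm_power frac_lt_1 less_imp_le intro!: mult_left_le_one_le summable_geometric)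
  then show ?thesis
    using sums_unique[OF g_H_sums[OF assms, of \<theta>]] suminf_geometric[of "norm z"] assms by simp
qed

text \<open>
  The crude bound for \<open>g\<^sub>H\<close> makes its term in the functional equation vanish at 1; this gives the
  density of the carries without any equidistribution theorem.
\<close>

lemma carry_series_stolz:
  assumes w: "(w \<longlongrightarrow> 1) F" and stolz: "\<forall>\<^sub>F x in F. w x \<in> stolz K"
  shows "((\<lambda>x. (1 - w x) * carry_series \<theta> p (w x)) \<longlongrightarrow> of_real (frac (real p * \<theta>))) F"
proof -
  let ?P = "\<lambda>z. (\<Sum>k<p. complex_of_real (frac (real k * \<theta>)) * z ^ k)"
  let ?d = "complex_of_real (frac (real p * \<theta>))"
  have null: "((\<lambda>x. ((1 - w x) * g_H \<theta> (w x)) * (1 - w x ^ p)) \<longlongrightarrow> 0) F"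
  proof (rule Lim_null_comparison)
    show "\<forall>\<^sub>F x in F. norm (((1 - w x) * g_H \<theta> (w x)) * (1 - w x ^ p)) \<le> K * norm (1 - w x ^ p)"
      using stolz
    proof eventually_elim
      case (elim x)
      then have x: "norm (w x) < 1" "norm (1 - w x) \<le> K * (1 - norm (w x))" by (auto simp: stolz_def)
      have "norm (1 - w x) * norm (g_H \<theta> (w x)) \<le> (K * (1 - norm (w x))) * (1 / (1 - norm (w x)))"
        using x by (intro mult_mono norm_g_H_le) (auto intro: order_trans[OF norm_ge_zero])
      also have "\<dots> = K" using x by simp
      finally show ?case by (simp add: norm_mult mult_right_mono)
    qed
    have "((\<lambda>x. K * norm (1 - w x ^ p)) \<longlongrightarrow> K * norm (1 - 1 ^ p :: complex)) F"
      by (intro tendsto_intros w)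
    then show "((\<lambda>x. K * norm (1 - w x ^ p)) \<longlongrightarrow> 0) F" by simp
  qed
  \<comment> \<open>This is the functional equation times \<open>1 - w x\<close>, solved for
    \<open>(1 - w x) * carry_series \<theta> p (w x)\<close>; only \<open>?d\<close> survives in the
    limit.\<close>
  have "((\<lambda>x. (((1 - w x) * ?P (w x)) - ((1 - w x) * g_H \<theta> (w x)) * (1 - w x ^ p)) / w x ^ p + ?d)
      \<longlongrightarrow> ((1 - 1) * ?P 1 - 0) / 1 ^ p + ?d) F"
    by (intro tendsto_intros w null) simp
  then have lim: "((\<lambda>x. (((1 - w x) * ?P (w x)) - ((1 - w x) * g_H \<theta> (w x)) * (1 - w x ^ p)) / w x ^ p + ?d)
      \<longlongrightarrow> ?d) F" by simp
  have "\<forall>\<^sub>F x in F. w x \<noteq> 0" by (rule tendsto_imp_eventually_ne[OF w]) simp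
  with stolz have "\<forall>\<^sub>F x in F. (((1 - w x) * ?P (w x)) - ((1 - w x) * g_H \<theta> (w x)) * (1 - w x ^ p)) / w x ^ p + ?d
      = (1 - w x) * carry_series \<theta> p (w x)"
  proof eventually_elim
    case (elim x)
    then have x: "norm (w x) < 1" "w x \<noteq> 1" by (auto simp: stolz_def)
    have "(1 - w x) * g_H \<theta> (w x) * (1 - w x ^ p)
      = (1 - w x) * (?P (w x) + w x ^ p * (?d / (1 - w x) - carry_series \<theta> p (w x)))"
      by (simp only: g_H_functional_equation[OF x(1), of \<theta> p] mult.assoc)
    also have "\<dots> = (1 - w x) * ?P (w x)
        + w x ^ p * ((1 - w x) * (?d / (1 - w x)) - (1 - w x) * carry_series \<theta> p (w x))"
      by (simp only: distrib_left right_diff_distrib mult.left_commute)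
    also have "(1 - w x) * (?d / (1 - w x)) = ?d" using x by simp
    finally show ?case using elim(2) by (simp add: field_simps)
  qed
  with lim show ?thesis by (rule Lim_transform_eventually)
qed

section \<open>Growth at the points \<open>cis (- 2 * pi * m * \<theta>)\<close>\<close>

lemma norm_cis_diff_1_le: "norm (cis x - 1) \<le> \<bar>x\<bar>"
proof -
  have "norm (cis x - 1) = 2 * \<bar>sin (x / 2)\<bar>"
    using dist_exp_i_1[of x] by (simp add: cis_conv_exp)
  also have "\<dots> \<le> 2 * \<bar>x / 2\<bar>" by (intro mult_left_mono abs_sin_x_le_abs_x) auto
  finally show ?thesis by simp
qed

lemma cis_2pi_cong:
  assumes "x - y \<in> \<int>"
  shows "cis (2 * pi * x) = cis (2 * pi * y)"
  using cis_multiple_2pi[OF assms] cis_mult[of "2 * pi * (x - y)" "2 * pi * y"] by (simp add: algebra_simps)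

text \<open>A carry puts \<open>k \<theta>\<close> within \<open>{p \<theta>}\<close> below an integer, so twisting by \<open>e\<^bsup>-2\<pi>imk\<theta>\<^esup>\<close> hardly matters.\<close>

lemma carry_twist_le:
  fixes m :: int
  shows "norm (carry \<theta> p k * (cis (- 2 * pi * of_int m * \<theta>) ^ k - 1))
    \<le> norm (carry \<theta> p k) * (2 * pi * \<bar>of_int m\<bar> * frac (real p * \<theta>))"
proof (cases "carry \<theta> p k = 0")
  case False
  \<comment> \<open>\<open>?y\<close> is the distance from \<open>k * \<theta>\<close> up to the
    next integer, so \<open>- m * k * \<theta>\<close> and \<open>m * ?y\<close> agree modulo
    1.\<close>
  let ?y = "1 - frac (real k * \<theta>)"
  have y: "\<bar>?y\<bar> \<le> frac (real p * \<theta>)"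
    using False frac_lt_1[of "real k * \<theta>"] by (auto simp: carry_def split: if_splits)
  have "of_int (- m) * (real k * \<theta>) - of_int m * ?y = of_int (- m * (\<lfloor>real k * \<theta>\<rfloor> + 1))"
    by (simp add: frac_def algebra_simps)
  then have "of_int (- m) * (real k * \<theta>) - of_int m * ?y \<in> \<int>" by simp
  moreover have arg: "real k * (- 2 * pi * of_int m * \<theta>) = 2 * pi * (of_int (- m) * (real k * \<theta>))"
    by simp
  ultimately have "cis (- 2 * pi * of_int m * \<theta>) ^ k = cis (2 * pi * (of_int m * ?y))"
    unfolding Complex.DeMoivre arg by (metis cis_2pi_cong)
  then have "norm (cis (- 2 * pi * of_int m * \<theta>) ^ k - 1) \<le> \<bar>2 * pi * (of_int m * ?y)\<bar>"
    using norm_cis_diff_1_le by metis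
  also have "\<dots> = 2 * pi * \<bar>of_int m\<bar> * \<bar>?y\<bar>" by (simp add: abs_mult)
  also have "\<dots> \<le> 2 * pi * \<bar>of_int m\<bar> * frac (real p * \<theta>)" by (intro mult_left_mono y) auto
  finally show ?thesis by (simp add: norm_mult mult_left_mono)
qed simp

text \<open>In the functional equation at \<open>q * z\<close>, the factor \<open>1 - z\<close>
  kills in the limit all terms bounded near \<open>q \<noteq> 1\<close>; the carry term stays, with
  size about \<open>d\<close>. Since \<open>1 - (q * z) ^ p\<close> is of order
  \<open>M * d\<close>, dividing by it cancels \<open>d\<close>, and the constant is independent of
  \<open>K\<close>.\<close>

lemma g_H_stolz_lower_bound:
  fixes m :: int
  assumes \<theta>: "\<theta> \<notin> \<rat>" and m: "m \<noteq> 0" and K: "1 \<le> K"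
  defines "q \<equiv> cis (- 2 * pi * of_int m * \<theta>)"
  shows "\<forall>\<^sub>F z in at 1 within stolz K. 1 / (8 * pi * \<bar>of_int m\<bar>) \<le> norm ((1 - z) * g_H \<theta> (q * z))"
proof -
  define M where "M = real_of_int \<bar>m\<bar>"
  have M: "1 \<le> M" using m by (simp add: M_def)
  \<comment> \<open>This tolerance makes the twisting error below at most
    \<open>d / 4\<close>.\<close>
  obtain p where p: "p > 0" "\<bar>frac (real p * \<theta>) - 0\<bar> < 1 / (16 * pi * K * M)"
    using Kronecker_approx_1_explicit[OF \<theta>, of 0 "1 / (16 * pi * K * M)"] K M by auto
  define d where "d = frac (real p * \<theta>)"
  have "real p * \<theta> \<notin> \<int>" using irrational_int_mult[OF \<theta>, of "int p"] p by simp
  then have d: "0 < d" "16 * pi * K * M * d \<le> 1"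
    using p K M by (auto simp: d_def field_simps)
  let ?F = "at 1 within stolz K"
  have stolz: "\<forall>\<^sub>F z in ?F. z \<in> stolz K" by (simp add: eventually_at_filter)
  have id: "((\<lambda>z. z) \<longlongrightarrow> 1) ?F" by (rule tendsto_ident_at)
  have nq: "norm q = 1" by (simp add: q_def)
  have "q \<noteq> 1"
  proof
    assume "q = 1"
    then obtain n :: int where "- 2 * pi * of_int m * \<theta> = of_int (2 * n) * pi"
      unfolding q_def cis_conv_exp exp_eq_1 by auto
    then have "(2 * pi) * (of_int m * \<theta>) = (2 * pi) * of_int (- n)" by simp
    then have "of_int m * \<theta> = of_int (- n)" by (subst (asm) mult_cancel_left) simp
    then show False using irrational_int_mult[OF \<theta> m] by (metis Ints_of_int)
  qed
  let ?P = "\<lambda>z. (\<Sum>k<p. complex_of_real (frac (real k * \<theta>)) * z ^ k)"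
  \<comment> \<open>\<open>T\<close> is \<open>1 - z\<close> times the right-hand side of the
    functional equation at \<open>q * z\<close>, with the carry series evaluated at \<open>z\<close>
    instead, where its growth is known.\<close>
  define T where "T z = (1 - z) * ?P (q * z)
    + (q * z) ^ p * (of_real d * ((1 - z) / (1 - q * z)) - (1 - z) * carry_series \<theta> p z)" for z
  have "(T \<longlongrightarrow> (1 - 1) * ?P (q * 1) + (q * 1) ^ p * (of_real d * ((1 - 1) / (1 - q * 1)) - of_real d)) ?F"
    unfolding T_def d_def
    by (intro tendsto_intros id carry_series_stolz[OF _ stolz]) (use \<open>q \<noteq> 1\<close> in auto)
  then have "((\<lambda>z. norm (T z)) \<longlongrightarrow> d) ?F"
    using d nq by (auto simp: norm_mult norm_power dest: tendsto_norm)
  then have T: "\<forall>\<^sub>F z in ?F. 3 / 4 * d < norm (T z)"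
    by (rule order_tendstoD) (use d in simp)
  \<comment> \<open>The error estimate sums moduli and so leads to the carry series at the real
    point \<open>norm z\<close>, which lies in the Stolz angle of aperture 1.\<close>
  have "((\<lambda>z. (1 - of_real (norm z)) * carry_series \<theta> p (of_real (norm z))) \<longlongrightarrow> of_real d) ?F"
    unfolding d_def
  proof (rule carry_series_stolz)
    have "((\<lambda>z. complex_of_real (norm z)) \<longlongrightarrow> of_real (norm (1::complex))) ?F" by (intro tendsto_intros)
    then show "((\<lambda>z. complex_of_real (norm z)) \<longlongrightarrow> 1) ?F" by simp
    show "\<forall>\<^sub>F z in ?F. complex_of_real (norm z) \<in> stolz 1"
      using stolz by eventually_elim (auto simp: stolz_def norm_one_minus_of_real)
  qed
  from tendsto_norm[OF this]
  have C: "\<forall>\<^sub>F z in ?F. norm ((1 - of_real (norm z)) * carry_series \<theta> p (of_real (norm z))) < 2 * d"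
    by (rule order_tendstoD) (use d in simp)
  \<comment> \<open>The integer part of \<open>p * \<theta>\<close> drops out, which puts
    \<open>q ^ p\<close> within \<open>2 * pi * M * d\<close> of 1.\<close>
  have "cis (- 2 * pi * of_int m * \<theta>) ^ p = cis (2 * pi * (- of_int m * d))"
  proof -
    have "- of_int m * (real p * \<theta>) - (- of_int m * d) = of_int (- m * \<lfloor>real p * \<theta>\<rfloor>)"
      by (simp add: d_def frac_def algebra_simps)
    then have "- of_int m * (real p * \<theta>) - (- of_int m * d) \<in> \<int>" by simp
    moreover have arg: "real p * (- 2 * pi * of_int m * \<theta>) = 2 * pi * (- of_int m * (real p * \<theta>))"
      by simp
    ultimately show ?thesis unfolding Complex.DeMoivre arg by (metis cis_2pi_cong)
  qed
  then have "norm (q ^ p - 1) \<le> \<bar>2 * pi * (- of_int m * d)\<bar>"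
    unfolding q_def using norm_cis_diff_1_le by metis
  also have "\<dots> = 2 * pi * M * d" using d by (simp add: abs_mult M_def)
  also have "\<dots> < 4 * pi * M * d" using d M by simp
  finally have "norm (1 - (q * 1) ^ p) < 4 * pi * M * d" by (simp add: norm_minus_commute)
  moreover have "((\<lambda>z. norm (1 - (q * z) ^ p)) \<longlongrightarrow> norm (1 - (q * 1) ^ p)) ?F"
    by (intro tendsto_intros id)
  ultimately have Q: "\<forall>\<^sub>F z in ?F. norm (1 - (q * z) ^ p) < 4 * pi * M * d"
    by (intro order_tendstoD)
  from stolz T C Q show ?thesis
  proof eventually_elim
    case (elim z)
    then have z: "norm z < 1" "norm (1 - z) \<le> K * (1 - norm z)" by (auto simp: stolz_def)
    have qz: "norm (q * z) < 1" using z nq by (simp add: norm_mult)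
    let ?r = "complex_of_real (norm z)"
    have r: "norm ?r < 1" using z by simp
    \<comment> \<open>The coefficients are 0 or 1, so the sum of moduli is the series at
      \<open>norm z\<close>, a nonnegative real.\<close>
    have carry_r: "(\<lambda>k. norm (carry \<theta> p k) * norm z ^ k) sums norm (carry_series \<theta> p ?r)"
    proof -
      have "complex_of_real (norm (carry \<theta> p k)) = carry \<theta> p k" for k by (simp add: carry_def)
      then have "(\<lambda>k. complex_of_real (norm (carry \<theta> p k) * norm z ^ k)) sums carry_series \<theta> p ?r"
        using carry_series_sums[OF r, of \<theta> p] by simp
      moreover from this have re: "(\<lambda>k. norm (carry \<theta> p k) * norm z ^ k) sums Re (carry_series \<theta> p ?r)"
        using sums_Re by fastforce
      ultimately have "carry_series \<theta> p ?r = of_real (Re (carry_series \<theta> p ?r))"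
        using sums_of_real sums_unique2 by blast
      moreover have "0 \<le> Re (carry_series \<theta> p ?r)"
        using sums_le[OF _ sums_zero re] by simp
      ultimately show ?thesis using re by (metis abs_of_nonneg norm_of_real)
    qed
    have "(\<lambda>k. carry \<theta> p k * (q ^ k - 1) * z ^ k) sums (carry_series \<theta> p (q * z) - carry_series \<theta> p z)"
      using sums_diff[OF carry_series_sums[OF qz, of \<theta> p] carry_series_sums[OF z(1), of \<theta> p]]
      by (simp add: algebra_simps power_mult_distrib)
    then have "norm (carry_series \<theta> p (q * z) - carry_series \<theta> p z)
      \<le> norm (carry_series \<theta> p ?r) * (2 * pi * M * d)"
    proof (rule norm_sums_le[OF _ sums_mult2[OF carry_r]])
      show "norm (carry \<theta> p k * (q ^ k - 1) * z ^ k) \<le> norm (carry \<theta> p k) * norm z ^ k * (2 * pi * M * d)" for k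
        using mult_right_mono[OF carry_twist_le[of \<theta> p k m], of "norm z ^ k"]
        by (simp add: q_def d_def M_def norm_mult norm_power mult_ac)
    qed
    then have "norm ((1 - z) * (carry_series \<theta> p (q * z) - carry_series \<theta> p z))
       \<le> (K * (1 - norm z)) * (norm (carry_series \<theta> p ?r) * (2 * pi * M * d))"
      unfolding norm_mult using z K by (intro mult_mono) auto
    also have "\<dots> = (K * (2 * pi * M * d)) * norm ((1 - ?r) * carry_series \<theta> p ?r)"
      using z by (simp add: norm_mult norm_one_minus_of_real)
    also have "\<dots> \<le> (K * (2 * pi * M * d)) * (2 * d)"
      using elim(3) K M d by (intro mult_left_mono) auto
    also have "\<dots> = (16 * pi * K * M * d) * (d / 4)" by simp
    also have "\<dots> \<le> 1 * (d / 4)" using d by (intro mult_right_mono) auto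
    finally have err: "norm ((1 - z) * (carry_series \<theta> p (q * z) - carry_series \<theta> p z)) \<le> d / 4" by simp
    have "norm (q * z) ^ p \<le> 1" using qz by (intro power_le_one) auto
    then have "norm ((q * z) ^ p * ((1 - z) * (carry_series \<theta> p (q * z) - carry_series \<theta> p z))) \<le> 1 * (d / 4)"
      unfolding norm_mult[of "(q * z) ^ p"] norm_power by (intro mult_mono err) auto
    moreover have "(1 - z) * g_H \<theta> (q * z) * (1 - (q * z) ^ p)
      = T z - (q * z) ^ p * ((1 - z) * (carry_series \<theta> p (q * z) - carry_series \<theta> p z))"
    proof -
      have "(1 - z) * (g_H \<theta> (q * z) * (1 - (q * z) ^ p)) = (1 - z) * (?P (q * z) + (q * z) ^ p * (of_real d / (1 - q * z) - carry_series \<theta> p (q * z)))"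
        using g_H_functional_equation[OF qz, of \<theta> p] by (simp add: d_def)
      then show ?thesis unfolding T_def by (simp add: algebra_simps)
    qed
    \<comment> \<open>The main term exceeds \<open>3 / 4 * d\<close> and the error is at most
      \<open>d / 4\<close>.\<close>
    ultimately have "d / 2 \<le> norm ((1 - z) * g_H \<theta> (q * z) * (1 - (q * z) ^ p))"
      using elim(2) norm_triangle_ineq2[of "T z" "(q * z) ^ p * ((1 - z) * (carry_series \<theta> p (q * z) - carry_series \<theta> p z))"]
      by simp
    also have "\<dots> \<le> norm ((1 - z) * g_H \<theta> (q * z)) * (4 * pi * M * d)"
      unfolding norm_mult[of _ "1 - (q * z) ^ p"] using elim(4) by (intro mult_left_mono) auto
    finally have "d / 2 / (4 * pi * M * d) \<le> norm ((1 - z) * g_H \<theta> (q * z))"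
      using d M by (subst pos_divide_le_eq) auto
    then show ?case using d M by (simp add: M_def)
  qed
qed

section \<open>Divergence of the integrals over arcs\<close>

lemma nn_integral_reciprocal_shift:
  assumes "0 < c" "0 < u" "0 \<le> K"
  shows "(\<integral>\<^sup>+x\<in>{a..a + K * u}. ennreal (c / (u + (x - a))) \<partial>lborel) = ennreal (c * ln (1 + K))"
proof -
  have "(\<integral>\<^sup>+x\<in>{a..a + K * u}. ennreal (c / (u + (x - a))) \<partial>lborel)
    = ennreal (c * ln (u + ((a + K * u) - a)) - c * ln (u + (a - a)))"
  proof (rule nn_integral_FTC_Icc)
    show "((\<lambda>x. c * ln (u + (x - a))) has_real_derivative c / (u + (x - a))) (at x)"
      if "x \<in> {a..a + K * u}" for x
      using that assms by (auto intro!: derivative_eq_intros simp: field_simps)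
  qed (use assms in auto)
  \<comment> \<open>The scale \<open>u\<close> cancels, so the bound depends only on
    \<open>c\<close> and \<open>K\<close>, however close to the circle the radius has to be.\<close>
  also have "c * ln (u + ((a + K * u) - a)) - c * ln (u + (a - a)) = c * ln (1 + K)"
    using assms ln_mult[of u "1 + K"] by (simp add: algebra_simps)
  finally show ?thesis .
qed

lemma dense_angles:
  fixes \<theta> :: real
  assumes \<theta>: "\<theta> \<notin> \<rat>" and "\<omega>\<^sub>1 < \<omega>\<^sub>2"
  obtains m :: int and \<omega> where "m \<noteq> 0" "\<omega>\<^sub>1 < \<omega>" "\<omega> < \<omega>\<^sub>2" "cis \<omega> = cis (- 2 * pi * of_int m * \<theta>)"
proof -
  \<comment> \<open>The target is the midpoint of the interval in units of a full turn, negated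
    because the angles are negative multiples of \<open>\<theta>\<close>; \<open>\<epsilon>\<close>
    is half the length in the same unit.\<close>
  define \<alpha> where "\<alpha> = - (\<omega>\<^sub>1 + \<omega>\<^sub>2) / 2 / (2 * pi)"
  define \<epsilon> where "\<epsilon> = (\<omega>\<^sub>2 - \<omega>\<^sub>1) / 2 / (2 * pi)"
  have "\<epsilon> > 0" using assms by (simp add: \<epsilon>_def)
  then obtain h k :: int where k: "k > 0" "\<bar>of_int k * \<theta> - of_int h - \<alpha>\<bar> < \<epsilon>"
    using sequence_of_fractional_parts_is_dense[OF \<theta>] by blast
  define \<omega> where "\<omega> = 2 * pi * (of_int h - of_int k * \<theta>)"
  have *: "\<bar>2 * pi * (of_int k * \<theta> - of_int h - \<alpha>)\<bar> < 2 * pi * \<epsilon>"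
    using k(2) by (simp add: abs_mult)
  have "\<bar>(\<omega>\<^sub>1 + \<omega>\<^sub>2) / 2 - \<omega>\<bar> < (\<omega>\<^sub>2 - \<omega>\<^sub>1) / 2"
  proof -
    have "2 * pi * (of_int k * \<theta> - of_int h - \<alpha>) = (\<omega>\<^sub>1 + \<omega>\<^sub>2) / 2 - \<omega>"
      by (simp add: \<omega>_def \<alpha>_def field_simps)
    moreover have "2 * pi * \<epsilon> = (\<omega>\<^sub>2 - \<omega>\<^sub>1) / 2" by (simp add: \<epsilon>_def)
    ultimately show ?thesis using * by (simp only:)
  qed
  moreover have "cis \<omega> = cis (2 * pi * (- of_int k * \<theta>))"
    unfolding \<omega>_def by (intro cis_2pi_cong) simp
  moreover from calculation(1) have "\<omega>\<^sub>1 < \<omega>" "\<omega> < \<omega>\<^sub>2"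
    by (simp_all add: abs_less_iff field_simps)
  ultimately show thesis using that[of k \<omega>] k(1) by (simp add: mult_ac)
qed

text \<open>At radius \<open>1 - u\<close>, the point at angle \<open>x\<close> of the arc is within
  \<open>u + (x - a)\<close> of the singular point \<open>cis a\<close>, so \<open>g_H\<close> has
  modulus at least \<open>c / (u + (x - a))\<close> there. The constant \<open>c\<close> is fixed
  before \<open>K\<close>, so \<open>K\<close> can later tend to infinity.\<close>

lemma g_H_integral_lower_bound:
  fixes \<theta> :: real
  assumes \<theta>: "\<theta> \<notin> \<rat>" and lt: "\<omega>\<^sub>1 < \<omega>\<^sub>2"
  obtains c where "c > 0" "\<And>K. 0 \<le> K \<Longrightarrow> \<exists>r\<in>{0<..<1}. ennreal (c * ln (1 + K)) \<le>
    (\<integral>\<^sup>+\<omega>\<in>{\<omega>\<^sub>1<..<\<omega>\<^sub>2}. ennreal (norm (g_H \<theta> (complex_of_real r * cis \<omega>))) \<partial>lborel)"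
proof -
  obtain m :: int and a where m: "m \<noteq> 0" and a: "\<omega>\<^sub>1 < a" "a < \<omega>\<^sub>2" "cis a = cis (- 2 * pi * of_int m * \<theta>)"
    using dense_angles[OF \<theta> lt] by metis
  define c where "c = 1 / (8 * pi * \<bar>real_of_int m\<bar>)"
  have c: "c > 0" using m by (simp add: c_def)
  have "\<exists>r\<in>{0<..<1}. ennreal (c * ln (1 + K)) \<le>
    (\<integral>\<^sup>+\<omega>\<in>{\<omega>\<^sub>1<..<\<omega>\<^sub>2}. ennreal (norm (g_H \<theta> (complex_of_real r * cis \<omega>))) \<partial>lborel)" if K: "0 \<le> K" for K
  proof -
    obtain e where e: "e > 0" "\<And>z. z \<in> stolz (1 + K) \<Longrightarrow> z \<noteq> 1 \<Longrightarrow> dist z 1 < e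
        \<Longrightarrow> c \<le> norm ((1 - z) * g_H \<theta> (cis a * z))"
      using g_H_stolz_lower_bound[OF \<theta> m, of "1 + K"] K unfolding c_def a(3) eventually_at by auto
    \<comment> \<open>Dividing by \<open>1 + K\<close> keeps the arc \<open>{a..a + K * u}\<close>
      inside the interval and its points within \<open>e\<close> of the singular point;
      \<open>1 / 2\<close> keeps the radius positive.\<close>
    define u where "u = min (1 / 2) (min (e / 2) ((\<omega>\<^sub>2 - a) / 2) / (1 + K))"
    have u: "0 < u" "u < 1" using e(1) a K by (auto simp: u_def)
    have "u \<le> min (e / 2) ((\<omega>\<^sub>2 - a) / 2) / (1 + K)" by (simp add: u_def)
    then have u2: "(1 + K) * u \<le> min (e / 2) ((\<omega>\<^sub>2 - a) / 2)" using K by (simp add: field_simps)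
    then have "(1 + K) * u < e" using e(1) by linarith
    have "a + K * u < \<omega>\<^sub>2" using u2 u a by (simp add: algebra_simps)
    have *: "c / (u + (x - a)) \<le> norm (g_H \<theta> (complex_of_real (1 - u) * cis x))"
      if x: "x \<in> {a..a + K * u}" for x
    proof -
      \<comment> \<open>Rotation by \<open>- a\<close> moves the vertex to 1; as
        \<open>1 - norm z = u\<close>, the bound \<open>(1 + K) * u\<close> on
        \<open>norm (1 - z)\<close> is membership in the Stolz angle.\<close>
      define z where "z = complex_of_real (1 - u) * cis (x - a)"
      have nz: "norm z = 1 - u" using u by (simp only: z_def norm_mult norm_of_real norm_cis) simp
      have "1 - z = of_real u - of_real (1 - u) * (cis (x - a) - 1)" by (simp add: z_def algebra_simps)
      also have "norm \<dots> \<le> \<bar>u\<bar> + \<bar>1 - u\<bar> * norm (cis (x - a) - 1)"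
        by (rule order_trans[OF norm_triangle_ineq4]) (simp only: norm_mult norm_of_real order_refl)
      also have "\<dots> \<le> \<bar>u\<bar> + 1 * \<bar>x - a\<bar>"
        using u by (intro add_left_mono mult_mono norm_cis_diff_1_le) auto
      finally have n1: "norm (1 - z) \<le> u + (x - a)" using u x by simp
      also have "\<dots> \<le> (1 + K) * u" using x by (simp add: algebra_simps)
      finally have n2: "norm (1 - z) \<le> (1 + K) * u" .
      have "z \<in> stolz (1 + K)" using n2 nz u by (simp add: stolz_def)
      moreover have "z \<noteq> 1" using nz u by auto
      moreover have "dist z 1 < e"
        using n2 \<open>(1 + K) * u < e\<close> by (simp add: dist_norm norm_minus_commute)
      ultimately have "c \<le> norm ((1 - z) * g_H \<theta> (cis a * z))" by (rule e(2))
      also have "\<dots> \<le> (u + (x - a)) * norm (g_H \<theta> (cis a * z))"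
        unfolding norm_mult by (intro mult_right_mono n1) auto
      also have "cis a * z = complex_of_real (1 - u) * cis x"
        by (simp add: z_def cis_mult mult.left_commute)
      finally show ?thesis using u x by (simp add: field_simps)
    qed
    have "ennreal (c * ln (1 + K)) = (\<integral>\<^sup>+x\<in>{a..a + K * u}. ennreal (c / (u + (x - a))) \<partial>lborel)"
      using nn_integral_reciprocal_shift[OF c u(1) K] by simp
    also have "\<dots> \<le> (\<integral>\<^sup>+\<omega>\<in>{\<omega>\<^sub>1<..<\<omega>\<^sub>2}. ennreal (norm (g_H \<theta> (complex_of_real (1 - u) * cis \<omega>))) \<partial>lborel)"
      using * \<open>a + K * u < \<omega>\<^sub>2\<close> a(1)
      by (intro nn_integral_mono) (auto simp: indicator_def intro!: ennreal_leI simp del: of_real_diff)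
    finally show ?thesis using u by (intro bexI[of _ "1 - u"]) auto
  qed
  with c that show thesis by blast
qed

lemma SUP_eq_infinity_if_log_bound:
  fixes f :: "'a \<Rightarrow> ennreal"
  assumes "c > 0" "\<And>K. 0 \<le> K \<Longrightarrow> \<exists>r\<in>A. ennreal (c * ln (1 + K)) \<le> f r"
  shows "(SUP r\<in>A. f r) = \<infinity>"
proof -
  have "ennreal B \<le> (SUP r\<in>A. f r)" if "0 \<le> B" for B
  proof -
    \<comment> \<open>This value of \<open>K\<close> solves
      \<open>c * ln (1 + K) = B\<close>.\<close>
    have "0 \<le> exp (B / c) - 1" using assms(1) that by simp
    then obtain r where "r \<in> A" "ennreal (c * ln (1 + (exp (B / c) - 1))) \<le> f r"
      using assms(2) by blast
    then show ?thesis using assms(1) by (auto intro: SUP_upper2)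
  qed
  note bound = this
  show ?thesis
  proof (cases "SUP r\<in>A. f r" rule: ennreal_cases)
    case (real B)
    with bound[of "B + 1"] show ?thesis by simp
  qed simp
qed

lemma strong_natural_boundary_g_H:
  assumes \<theta>: "\<theta> \<notin> \<rat>"
  shows "strong_natural_boundary (g_H \<theta>)"
  unfolding strong_natural_boundary_def
proof (intro conjI allI impI)
  show "g_H \<theta> holomorphic_on unit_disc"
    using g_H_sums by (intro power_series_holomorphic[where a = "\<lambda>k. of_real (frac (real k * \<theta>))"]) auto
  fix \<omega>\<^sub>1 \<omega>\<^sub>2 :: real
  assume "\<omega>\<^sub>1 < \<omega>\<^sub>2"
  show "(SUP r\<in>{0<..<1}. \<integral>\<^sup>+\<omega>\<in>{\<omega>\<^sub>1<..<\<omega>\<^sub>2}. ennreal (norm (g_H \<theta> (complex_of_real r * cis \<omega>))) \<partial>lborel) = \<infinity>"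
    by (rule g_H_integral_lower_bound[OF \<theta> \<open>\<omega>\<^sub>1 < \<omega>\<^sub>2\<close>])
      (erule SUP_eq_infinity_if_log_bound, blast)
qed

text \<open>Dividing by \<open>z\<close> cannot decrease the modulus inside the disc, so the
  integrals dominate those of \<open>g_H\<close>.\<close>

lemma strong_natural_boundary_g_H_shift:
  assumes \<theta>: "\<theta> \<notin> \<rat>"
  shows "strong_natural_boundary (g_H_shift \<theta>)"
  unfolding strong_natural_boundary_def
proof (intro conjI allI impI)
  show "g_H_shift \<theta> holomorphic_on unit_disc"
    using g_H_shift_sums by (intro power_series_holomorphic[where a = "\<lambda>k. of_real (frac (real (k + 1) * \<theta>))"]) auto
  fix \<omega>\<^sub>1 \<omega>\<^sub>2 :: real
  assume lt: "\<omega>\<^sub>1 < \<omega>\<^sub>2"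
  let ?I = "\<lambda>g r. \<integral>\<^sup>+\<omega>\<in>{\<omega>\<^sub>1<..<\<omega>\<^sub>2}. ennreal (norm (g (complex_of_real r * cis \<omega>) :: complex)) \<partial>lborel"
  have "?I (g_H \<theta>) r \<le> ?I (g_H_shift \<theta>) r" if "r \<in> {0<..<1}" for r
  proof (intro nn_integral_mono mult_right_mono ennreal_leI)
    fix \<omega>
    have "norm (complex_of_real r * cis \<omega>) < 1" using that by (simp add: norm_mult)
    from g_H_eq_shift[OF this, of \<theta>]
    show "norm (g_H \<theta> (complex_of_real r * cis \<omega>)) \<le> norm (g_H_shift \<theta> (complex_of_real r * cis \<omega>))"
      using that by (simp add: norm_mult mult_left_le_one_le)
  qed simp
  then have "(SUP r\<in>{0<..<1}. ?I (g_H \<theta>) r) \<le> (SUP r\<in>{0<..<1}. ?I (g_H_shift \<theta>) r)"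
    by (intro SUP_subset_mono order_refl)
  also have "(SUP r\<in>{0<..<1}. ?I (g_H \<theta>) r) = \<infinity>"
    using strong_natural_boundary_g_H[OF \<theta>] lt unfolding strong_natural_boundary_def by blast
  finally show "(SUP r\<in>{0<..<1}. ?I (g_H_shift \<theta>) r) = \<infinity>"
    by (simp add: top_unique)
qed

section \<open>Continuations to the outer disc\<close>

lemma sphere_inverse_outer_disc:
  assumes "z \<in> outer_disc"
  shows "norm (sphere_inverse z) < 1"
  using assms by (auto simp: outer_disc_def sphere_inverse_def norm_inverse inverse_less_1_iff)

text \<open>Absolute convergence turns the unordered sum into an ordinary series through
  \<open>n = - 1 - k\<close>.\<close>

lemma outer_series_sums:
  assumes "bounded (range b)" and z: "z \<in> outer_disc"
  shows "(\<lambda>k. b (- 1 - int k) * sphere_inverse z ^ Suc k) sums (- outer_series b z)"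
proof -
  let ?w = "sphere_inverse z"
  have bij: "bij_betw (\<lambda>k. - 1 - int k) UNIV {..<0}"
    by (rule bij_betwI[where g = "\<lambda>n. nat (- 1 - n)"]) auto
  have "bounded (range (\<lambda>k. b (- 1 - int k) * ?w))"
  proof -
    obtain B where B: "\<And>n. norm (b n) \<le> B" using assms(1) by (auto simp: bounded_iff)
    show ?thesis
      unfolding bounded_iff by (intro exI[of _ "B * norm ?w"]) (auto simp: norm_mult intro!: mult_right_mono B)
  qed
  from norm_summable_imp_has_sum[OF bounded_powser_summable[OF this sphere_inverse_outer_disc[OF z]]
      summable_sums[OF summable_norm_cancel[OF bounded_powser_summable[OF this sphere_inverse_outer_disc[OF z]]]]]
  have hs: "((\<lambda>k. b (- 1 - int k) * ?w ^ Suc k) has_sum (\<Sum>k. b (- 1 - int k) * ?w ^ Suc k)) UNIV"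
    by (simp add: mult_ac)
  have "outer_series b z = - (\<Sum>\<^sub>\<infinity>k. b (- 1 - int k) * ?w ^ Suc k)"
    unfolding outer_series_def
    by (subst infsum_reindex_bij_betw[OF bij, symmetric]) (simp add: nat_add_distrib)
  with hs show ?thesis
    using has_sum_imp_sums[OF hs] by (simp add: infsumI)
qed

lemma g_H_minus_sums:
  assumes "z \<in> outer_disc"
  shows "(\<lambda>k. of_real (frac (- (1 + real k) * \<theta>)) * sphere_inverse z ^ Suc k) sums (- g_H_minus \<theta> z)"
  using outer_series_sums[OF bounded_frac assms, of "\<lambda>n. of_int n * \<theta>"] by (simp add: g_H_minus_def)

text \<open>For non-integers \<open>{-x} = 1 - {x}\<close>, and the ones form a geometric series
  starting at exponent 1. Its sum \<open>?w / (1 - ?w)\<close> is \<open>- 1 / (1 - z)\<close>, both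
  being 0 at infinity.\<close>

lemma g_H_minus_eq:
  assumes \<theta>: "\<theta> \<notin> \<rat>" and z: "z \<in> outer_disc"
  shows "g_H_minus \<theta> z = g_H \<theta> (sphere_inverse z) + sphere_inverse (map_option (\<lambda>w. 1 - w) z)"
proof -
  let ?w = "sphere_inverse z"
  have w: "norm ?w < 1" using z by (rule sphere_inverse_outer_disc)
  have neg: "frac (- (1 + real k) * \<theta>) = 1 - frac (real (k + 1) * \<theta>)" for k
    using irrational_int_mult[OF \<theta>, of "int (k + 1)"] frac_neg[of "real (k + 1) * \<theta>"]
    by (simp add: algebra_simps)
  have "(\<lambda>k. ?w * ?w ^ k - ?w * (of_real (frac (real (k + 1) * \<theta>)) * ?w ^ k)) sums
    (?w * (1 / (1 - ?w)) - ?w * g_H_shift \<theta> ?w)"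
    by (intro sums_diff sums_mult geometric_sums g_H_shift_sums w)
  then have "(\<lambda>k. of_real (frac (- (1 + real k) * \<theta>)) * ?w ^ Suc k) sums (?w / (1 - ?w) - g_H \<theta> ?w)"
    unfolding neg g_H_eq_shift[OF w] by (simp add: algebra_simps)
  then have "- g_H_minus \<theta> z = ?w / (1 - ?w) - g_H \<theta> ?w"
    using g_H_minus_sums[OF z] sums_unique2 by blast
  moreover have "sphere_inverse (map_option (\<lambda>w. 1 - w) z) = - (?w / (1 - ?w))"
    using z by (auto simp: outer_disc_def sphere_inverse_def divide_simps split: if_splits)
  ultimately show ?thesis by (simp add: algebra_simps)
qed

text \<open>The entry at \<open>- 1\<close> is left free to cover both right limits; it is the
  leading coefficient, and the later terms are those of \<open>g_H_minus\<close> moved by one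
  power.\<close>

lemma outer_series_shift:
  assumes b: "\<And>n. n \<noteq> - 1 \<Longrightarrow> b n = of_real (frac (of_int (n + 1) * \<theta>))" and z: "z \<in> outer_disc"
  shows "outer_series b z = - b (- 1) * sphere_inverse z + sphere_inverse z * g_H_minus \<theta> z"
proof -
  let ?w = "sphere_inverse z"
  have "bounded (range b)"
    unfolding bounded_iff
  proof (intro exI ballI)
    fix x assume "x \<in> range b"
    then obtain n where "x = b n" by auto
    then show "norm x \<le> max 1 (norm (b (- 1)))"
      using b[of n] frac_lt_1[of "of_int (n + 1) * \<theta>"] by (cases "n = - 1") auto
  qed
  from outer_series_sums[OF this z]
  have "(\<lambda>k. b (- 1 - int k) * ?w ^ Suc k) sums - outer_series b z" .
  moreover have "(\<lambda>k. b (- 1 - int k) * ?w ^ Suc k) sums (?w * - g_H_minus \<theta> z + b (- 1) * ?w)"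
  proof -
    have "b (- 1 - int (Suc k)) = of_real (frac (- (1 + real k) * \<theta>))" for k
      by (subst b) auto
    then have "(\<lambda>k. b (- 1 - int (Suc k)) * ?w ^ Suc (Suc k)) sums (?w * - g_H_minus \<theta> z)"
      using sums_mult[OF g_H_minus_sums[OF z, of \<theta>], of ?w] by (simp add: mult_ac)
    then show ?thesis by (subst (asm) sums_Suc_iff) simp
  qed
  ultimately have "- outer_series b z = ?w * - g_H_minus \<theta> z + b (- 1) * ?w"
    by (rule sums_unique2)
  then show ?thesis by (simp add: algebra_simps)
qed

section \<open>The sets of rrl-continuations\<close>

lemma rrl_continuations_g_H:
  assumes \<theta>: "\<theta> \<notin> \<rat>"
  shows "{h. rrl_continuation (g_H \<theta>) h} = {restrict (g_H_minus \<theta>) outer_disc}"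
proof -
  have "renascent_right_limit (\<lambda>k. of_real (frac (real k * \<theta>))) b
    \<longleftrightarrow> b = (\<lambda>n. of_real (frac (of_int n * \<theta>)))" for b
  proof -
    have "renascent_right_limit (\<lambda>k. of_real (frac (real k * \<theta>))) b
      \<longleftrightarrow> (\<forall>n. n \<noteq> 0 \<longrightarrow> b n = of_real (frac (of_int n * \<theta>))) \<and> b 0 = 0"
      using renascent_right_limit_frac_iff[OF \<theta>, of 0 b] by simp
    also have "\<dots> \<longleftrightarrow> (\<forall>n. b n = of_real (frac (of_int n * \<theta>)))"
      by (metis frac_of_int mult_zero_left of_int_0 of_real_0)
    finally show ?thesis by (simp only: fun_eq_iff)
  qed
  moreover have "rrl_continuation (g_H \<theta>) h \<longleftrightarrow>
      (\<exists>b. renascent_right_limit (\<lambda>k. of_real (frac (real k * \<theta>))) b \<and>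
         h = restrict (outer_series b) outer_disc)" for h
    using g_H_sums by (intro rrl_continuation_iff[OF bounded_frac]) auto
  ultimately show ?thesis by (simp add: g_H_minus_def)
qed

lemma rrl_continuations_g_H_shift:
  assumes \<theta>: "\<theta> \<notin> \<rat>"
  shows "{h. rrl_continuation (g_H_shift \<theta>) h} =
    {\<lambda>z\<in>outer_disc. sphere_inverse z * g_H_minus \<theta> z,
     \<lambda>z\<in>outer_disc. - sphere_inverse z + sphere_inverse z * g_H_minus \<theta> z}"
proof -
  \<comment> \<open>\<open>R c\<close> is the continuation belonging to the entry \<open>c\<close>
    at index \<open>- 1\<close>.\<close>
  define R where "R c = (\<lambda>z\<in>outer_disc. - c * sphere_inverse z + sphere_inverse z * g_H_minus \<theta> z)" for c
  have restr: "restrict (outer_series b) outer_disc = R (b (- 1))"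
    if "\<forall>n. n \<noteq> - 1 \<longrightarrow> b n = of_real (frac (of_int (n + 1) * \<theta>))" for b
    unfolding R_def using that by (intro restrict_ext outer_series_shift) auto
  have ren: "renascent_right_limit (\<lambda>k. of_real (frac (real (k + 1) * \<theta>))) b \<longleftrightarrow>
      (\<forall>n. n \<noteq> - 1 \<longrightarrow> b n = of_real (frac (of_int (n + 1) * \<theta>))) \<and> (b (- 1) = 0 \<or> b (- 1) = 1)" for b
    using renascent_right_limit_frac_iff[OF \<theta>, of 1 b] by simp
  have "rrl_continuation (g_H_shift \<theta>) h \<longleftrightarrow> h = R 0 \<or> h = R 1" for h
  proof -
    have "rrl_continuation (g_H_shift \<theta>) h \<longleftrightarrow>
      (\<exists>b. renascent_right_limit (\<lambda>k. of_real (frac (real (k + 1) * \<theta>))) b \<and>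
         h = restrict (outer_series b) outer_disc)"
      using g_H_shift_sums by (intro rrl_continuation_iff[OF bounded_frac]) auto
    also have "\<dots> \<longleftrightarrow> h = R 0 \<or> h = R 1"
    proof
      assume "h = R 0 \<or> h = R 1"
      then obtain c where c: "c = 0 \<or> c = 1" "h = R c" by auto
      define b where "b = (\<lambda>n. complex_of_real (frac (of_int (n + 1) * \<theta>)))(- 1 := c)"
      have "renascent_right_limit (\<lambda>k. of_real (frac (real (k + 1) * \<theta>))) b"
        unfolding ren using c(1) by (auto simp: b_def)
      moreover have "h = restrict (outer_series b) outer_disc"
        using c(2) by (subst restr) (auto simp: b_def)
      ultimately show "\<exists>b. renascent_right_limit (\<lambda>k. of_real (frac (real (k + 1) * \<theta>))) b \<and>
         h = restrict (outer_series b) outer_disc" by blast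
    qed (use ren restr in metis)
    finally show ?thesis .
  qed
  then show ?thesis by (auto simp: R_def)
qed

theorem proposition3p6:
  fixes \<theta> :: real
  assumes "\<theta> \<notin> \<rat>"
  shows
    "({h. rrl_continuation (g_H \<theta>) h} = {restrict (g_H_minus \<theta>) outer_disc} \<and>
      (\<forall>z\<in>outer_disc. g_H_minus \<theta> z =
         g_H \<theta> (sphere_inverse z) + sphere_inverse (map_option (\<lambda>w. 1 - w) z)))
     \<and>
     ((\<forall>z\<in>unit_disc - {0}. inverse z * g_H \<theta> z = g_H_shift \<theta> z) \<and>
      {h. rrl_continuation (g_H_shift \<theta>) h} =
         {\<lambda>z\<in>outer_disc. sphere_inverse z * g_H_minus \<theta> z,
          \<lambda>z\<in>outer_disc. - sphere_inverse z + sphere_inverse z * g_H_minus \<theta> z} \<and>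
      (\<lambda>z\<in>outer_disc. sphere_inverse z * g_H_minus \<theta> z) \<noteq>
         (\<lambda>z\<in>outer_disc. - sphere_inverse z + sphere_inverse z * g_H_minus \<theta> z) \<and>
      (\<forall>z\<in>outer_disc.
         outer_series (\<lambda>n. complex_of_real (frac (real_of_int (n + 1) * \<theta>))) z =
         sphere_inverse z * g_H_minus \<theta> z))
     \<and>
     (strong_natural_boundary (g_H \<theta>) \<and> strong_natural_boundary (g_H_shift \<theta>))"
proof (intro conjI)
  show "(\<lambda>z\<in>outer_disc. sphere_inverse z * g_H_minus \<theta> z) \<noteq>
         (\<lambda>z\<in>outer_disc. - sphere_inverse z + sphere_inverse z * g_H_minus \<theta> z)"
  proof
    assume "(\<lambda>z\<in>outer_disc. sphere_inverse z * g_H_minus \<theta> z) =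
         (\<lambda>z\<in>outer_disc. - sphere_inverse z + sphere_inverse z * g_H_minus \<theta> z)"
    \<comment> \<open>At the point 2 the two functions differ by 1/2.\<close>
    from fun_cong[OF this, of "Some 2"] show False
      by (simp add: outer_disc_def sphere_inverse_def)
  qed
  show "\<forall>z\<in>outer_disc. outer_series (\<lambda>n. complex_of_real (frac (real_of_int (n + 1) * \<theta>))) z =
         sphere_inverse z * g_H_minus \<theta> z"
    using outer_series_shift[of "\<lambda>n. complex_of_real (frac (real_of_int (n + 1) * \<theta>))" \<theta>] by simp
qed (use assms in \<open>simp_all add: g_H_minus_eq g_H_eq_shift rrl_continuations_g_H rrl_continuations_g_H_shift
    strong_natural_boundary_g_H strong_natural_boundary_g_H_shift\<close>)

end
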